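(* Let $Z=z_1e_1+z_2e_2$, $\mathcal{V}=\nu_1e_1+\nu_2e_2=\alpha+j\beta$ ($\alpha,\beta\in\mathbb{C}(i)$), $C=c_1e_1+c_2e_2\in\mathbb{BC}$ with $\Re(\alpha)+1>|\Im(\beta)|$. Then $$E_{\mathcal{V},C}(Z)=Z^{\mathcal{V}}\sum_{r=0}^{\infty}\frac{(CZ)^r}{\int_{\gamma}e^{-t}t^{\mathcal{V}+r}\,dt},$$ where $t=t_1e_1+t_2e_2\in\mathbb{BC}$ and $\gamma=(\gamma_1,\gamma_2)$ is the curve in $\mathbb{BC}$ with parametric equation $\gamma(t)=(\gamma(t_1),\gamma(t_2))$, $0<t_1,t_2<\infty$.
   Context: Bicomplex numbers: $\mathbb{BC}=\{w_1+jw_2: w_1,w_2\in\mathbb{C}(i)\}$, where $\mathbb{C}(i)$ is the complex field with unit $i$, $i^2=j^2=-1$, $ij=ji$. Put $e_1=\frac{1+ij}{2}$, $e_2=\frac{1-ij}{2}$, so $e_1+e_2=1$, $e_l^2=e_l$, $e_1e_2=0$. Every $Z=w_1+jw_2$ is uniquely $Z=z_1e_1+z_2e_2$ with $z_1=w_1-iw_2$, $z_2=w_1+iw_2\in\mathbb{C}(i)$, and addition, multiplication and division are componentwise in $e_1,e_2$; in particular $\nu_1=\alpha-i\beta$, $\nu_2=\alpha+i\beta$. Functions act componentwise: $\Gamma(Y)=\Gamma(y_1)e_1+\Gamma(y_2)e_2$ for $Y=y_1e_1+y_2e_2$ (with $1/\Gamma$ equal to $0$ at the poles of $\Gamma$),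 and $Z^{W}=z_1^{w_1}e_1+z_2^{w_2}e_2$ for $Z=z_1e_1+z_2e_2$, $W=w_1e_1+w_2e_2$ (principal complex powers; usual powers with $0^0=1$ for integer exponents); $e^{-t}=e^{-t_1}e_1+e^{-t_2}e_2$. Identities are understood for $Z$ at which the occurring powers are defined (e.g. $z_1z_2\neq0$). Bicomplex Miller-Ross function: $E_{\mathcal{V},C}(Z)=Z^{\mathcal{V}}\sum_{r=0}^{\infty}\frac{(CZ)^r}{\Gamma(\mathcal{V}+r+1)}$ for $\mathcal{V},C,Z\in\mathbb{BC}$. Integration: for a bicomplex curve $\gamma=(\gamma_1,\gamma_2)$ with component curves in $\mathbb{C}(i)$, $\int_\gamma f(t)\,dt=\left[\int_{\gamma_1}f_1(t_1)dt_1\right]e_1+\left[\int_{\gamma_2}f_2(t_2)dt_2\right]e_2$, where $f=f_1e_1+f_2e_2$ componentwise. Here $\gamma_1,\gamma_2$ are the half-line $(0,\infty)$ traversed from $0$ to $\infty$. *)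

theory Defs
  imports "HOL-Analysis.Analysis"
begin

text \<open>
  \<^term>\<open>Bicomplex w1 w2\<close> stands for \<open>w1 + j w2\<close>, with \<open>w1, w2\<close> in the complex field with unit \<open>i\<close>.
\<close>

datatype bicomplex = Bicomplex (bcfst: complex) (bcsnd: complex)

lemma bicomplex_eq_iff: "Z = W \<longleftrightarrow> bcfst Z = bcfst W \<and> bcsnd Z = bcsnd W"
  by (cases Z; cases W) auto

instantiation bicomplex :: comm_ring_1
begin

definition "0 = Bicomplex 0 0"
definition "1 = Bicomplex 1 0"
definition "Z + W = Bicomplex (bcfst Z + bcfst W) (bcsnd Z + bcsnd W)"
definition "Z - W = Bicomplex (bcfst Z - bcfst W) (bcsnd Z - bcsnd W)"
definition "- Z = Bicomplex (- bcfst Z) (- bcsnd Z)"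
definition "Z * W = Bicomplex (bcfst Z * bcfst W - bcsnd Z * bcsnd W)
                              (bcfst Z * bcsnd W + bcsnd Z * bcfst W)"

instance
  by standard
    (auto simp: bicomplex_eq_iff zero_bicomplex_def one_bicomplex_def plus_bicomplex_def
       minus_bicomplex_def uminus_bicomplex_def times_bicomplex_def algebra_simps)

end

lemma bc_components [simp]:
  "bcfst 0 = 0" "bcsnd 0 = 0" "bcfst 1 = 1" "bcsnd 1 = 0"
  "bcfst (Z + W) = bcfst Z + bcfst W" "bcsnd (Z + W) = bcsnd Z + bcsnd W"
  "bcfst (Z - W) = bcfst Z - bcfst W" "bcsnd (Z - W) = bcsnd Z - bcsnd W"
  "bcfst (- Z) = - bcfst Z" "bcsnd (- Z) = - bcsnd Z"
  "bcfst (Z * W) = bcfst Z * bcfst W - bcsnd Z * bcsnd W"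
  "bcsnd (Z * W) = bcfst Z * bcsnd W + bcsnd Z * bcfst W"
  by (simp_all add: zero_bicomplex_def one_bicomplex_def plus_bicomplex_def
       minus_bicomplex_def uminus_bicomplex_def times_bicomplex_def)

instantiation bicomplex :: real_vector
begin

definition "scaleR (a::real) Z = Bicomplex (a *\<^sub>R bcfst Z) (a *\<^sub>R bcsnd Z)"

instance
  by standard (auto simp: bicomplex_eq_iff scaleR_bicomplex_def algebra_simps)

end

instantiation bicomplex :: real_normed_vector
begin

definition "norm Z = sqrt ((cmod (bcfst Z))\<^sup>2 + (cmod (bcsnd Z))\<^sup>2)"
definition "sgn (Z::bicomplex) = Z /\<^sub>R norm Z"
definition "dist (Z::bicomplex) W = norm (Z - W)"
definition [code del]:
  "uniformity = (INF e\<in>{0<..}. principal {(Z::bicomplex, W). dist Z W < e})"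
definition [code del]:
  "open (U::bicomplex set) \<longleftrightarrow>
     (\<forall>Z\<in>U. eventually (\<lambda>(Z', W). Z' = Z \<longrightarrow> W \<in> U) uniformity)"

instance
proof
  have norm_eq: "norm Z = norm (bcfst Z, bcsnd Z)" for Z
    by (simp add: norm_bicomplex_def norm_prod_def)
  fix Z W :: bicomplex and a :: real
  show "sgn Z = Z /\<^sub>R norm Z" by (rule sgn_bicomplex_def)
  show "dist Z W = norm (Z - W)" by (rule dist_bicomplex_def)
  show "uniformity = (INF e\<in>{0<..}. principal {(Z::bicomplex, W). dist Z W < e})"
    by (rule uniformity_bicomplex_def)
  show "open U \<longleftrightarrow> (\<forall>Z\<in>U. eventually (\<lambda>(Z', W). Z' = Z \<longrightarrow> W \<in> U) uniformity)"
    for U :: "bicomplex set"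
    by (rule open_bicomplex_def)
  show "norm Z = 0 \<longleftrightarrow> Z = 0"
    by (simp add: norm_eq bicomplex_eq_iff zero_prod_def)
  show "norm (Z + W) \<le> norm Z + norm W"
    using norm_triangle_ineq[of "(bcfst Z, bcsnd Z)" "(bcfst W, bcsnd W)"] by (simp add: norm_eq)
  show "norm (a *\<^sub>R Z) = \<bar>a\<bar> * norm Z"
    using norm_scaleR[of a "(bcfst Z, bcsnd Z)"] by (simp add: norm_eq scaleR_bicomplex_def)
qed

end

definition bc_of :: "complex \<Rightarrow> bicomplex"
  where "bc_of w = Bicomplex w 0"

definition bc_j :: bicomplex
  where "bc_j = Bicomplex 0 1"

definition bc_e1 :: bicomplex
  where "bc_e1 = (1 / 2) *\<^sub>R (1 + bc_of \<i> * bc_j)"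

definition bc_e2 :: bicomplex
  where "bc_e2 = (1 / 2) *\<^sub>R (1 - bc_of \<i> * bc_j)"

text \<open>The idempotent components \<open>z1 = w1 - i w2\<close> and \<open>z2 = w1 + i w2\<close> of \<open>w1 + j w2\<close>.\<close>

definition bc_proj1 :: "bicomplex \<Rightarrow> complex"
  where "bc_proj1 Z = bcfst Z - \<i> * bcsnd Z"

definition bc_proj2 :: "bicomplex \<Rightarrow> complex"
  where "bc_proj2 Z = bcfst Z + \<i> * bcsnd Z"

definition bc_idem :: "complex \<Rightarrow> complex \<Rightarrow> bicomplex"
  where "bc_idem z1 z2 = bc_of z1 * bc_e1 + bc_of z2 * bc_e2"

lemma Bicomplex_eq: "Bicomplex w1 w2 = bc_of w1 + bc_j * bc_of w2"
  by (simp add: bicomplex_eq_iff bc_of_def bc_j_def)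

lemma bc_j_square: "bc_j * bc_j = - 1"
  by (simp add: bicomplex_eq_iff bc_j_def)

lemma bc_idem_explicit: "bc_idem z1 z2 = Bicomplex ((z1 + z2) / 2) (\<i> * (z1 - z2) / 2)"
  by (simp add: bc_idem_def bc_e1_def bc_e2_def bc_of_def bc_j_def scaleR_bicomplex_def
       bicomplex_eq_iff scaleR_conv_of_real field_simps)

lemma bc_proj_idem [simp]: "bc_proj1 (bc_idem z1 z2) = z1" "bc_proj2 (bc_idem z1 z2) = z2"
  by (simp_all add: bc_idem_explicit bc_proj1_def bc_proj2_def field_simps)

lemma bc_idem_proj [simp]: "bc_idem (bc_proj1 Z) (bc_proj2 Z) = Z"
  by (simp add: bc_idem_explicit bc_proj1_def bc_proj2_def bicomplex_eq_iff field_simps)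

lemma bc_idempotents:
  "bc_e1 + bc_e2 = 1" "bc_e1 * bc_e1 = bc_e1" "bc_e2 * bc_e2 = bc_e2" "bc_e1 * bc_e2 = 0"
  by (simp_all add: bc_e1_def bc_e2_def bc_of_def bc_j_def scaleR_bicomplex_def
       bicomplex_eq_iff scaleR_conv_of_real field_simps)

lemma bc_idem_arith:
  "bc_idem a b + bc_idem c d = bc_idem (a + c) (b + d)"
  "bc_idem a b * bc_idem c d = bc_idem (a * c) (b * d)"
  by (simp_all add: bc_idem_explicit bicomplex_eq_iff field_simps)

text \<open>
  Division is taken componentwise with respect to the idempotents, so for zero divisors it is
  totalized by \<open>x / 0 = 0\<close> in each component; for invertible denominators it is the usual quotient.
\<close>

instantiation bicomplex :: inverse
begin

definition "inverse Z = bc_idem (inverse (bc_proj1 Z)) (inverse (bc_proj2 Z))"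
definition "Z div W = bc_idem (bc_proj1 Z / bc_proj1 W) (bc_proj2 Z / bc_proj2 W)"

instance ..

end

definition bc_exp :: "bicomplex \<Rightarrow> bicomplex"
  where "bc_exp Z = bc_idem (exp (bc_proj1 Z)) (exp (bc_proj2 Z))"

text \<open>
  The library has \<open>Gamma z = 0\<close> at the poles, so that \<open>1 / bc_Gamma\<close> has component \<open>0\<close> there,
  which is the usual convention for the reciprocal.
\<close>

definition bc_Gamma :: "bicomplex \<Rightarrow> bicomplex"
  where "bc_Gamma Y = bc_idem (Gamma (bc_proj1 Y)) (Gamma (bc_proj2 Y))"

text \<open>
  Principal power, except that \<open>0\<close> to the power \<open>0\<close> is \<open>1\<close>, whereas \<open>0 powr 0 = 0\<close>.
  For integer \<open>w\<close> and \<open>z \<noteq> 0\<close> the principal power is the usual one.  If \<open>z = 0\<close> and \<open>w \<noteq> 0\<close>,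
  the value is \<open>0\<close>, which for \<open>Re w \<le> 0\<close> is a mere totalization.
\<close>

definition cpower :: "complex \<Rightarrow> complex \<Rightarrow> complex"
  where "cpower z w = (if z = 0 \<and> w = 0 then 1 else z powr w)"

definition bc_power :: "bicomplex \<Rightarrow> bicomplex \<Rightarrow> bicomplex"  (infixr \<open>bc'_powr\<close> 80)
  where "Z bc_powr W = bc_idem (cpower (bc_proj1 Z) (bc_proj1 W)) (cpower (bc_proj2 Z) (bc_proj2 W))"

lemma cpower_of_nat: "cpower z (of_nat n) = z ^ n"
  by (cases "z = 0") (auto simp: cpower_def powr_nat')

definition miller_ross :: "bicomplex \<Rightarrow> bicomplex \<Rightarrow> bicomplex \<Rightarrow> bicomplex"
  where "miller_ross V C Z = Z bc_powr V * (\<Sum>r. (C * Z) ^ r / bc_Gamma (V + of_nat r + 1))"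

text \<open>
  Integral of \<open>f\<close> along the curve \<open>g\<close> parametrized over an interval \<open>I\<close>, which may be unbounded;
  for \<open>I = {0..1}\<close> this is the formula that defines contour integrals in HOL-Complex_Analysis.
  The Henstock--Kurzweil integral over an unbounded interval includes the improper integrals.
\<close>

definition curve_integrable :: "(complex \<Rightarrow> complex) \<Rightarrow> (real \<Rightarrow> complex) \<Rightarrow> real set \<Rightarrow> bool"
  where "curve_integrable f g I \<longleftrightarrow>
    (\<lambda>x. f (g x) * vector_derivative g (at x within I)) integrable_on I"

definition curve_integral :: "(complex \<Rightarrow> complex) \<Rightarrow> (real \<Rightarrow> complex) \<Rightarrow> real set \<Rightarrow> complex"
  where "curve_integral f g I = integral I (\<lambda>x. f (g x) * vector_derivative g (at x within I))"

text \<open>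
  The components \<open>f1, f2\<close> of a function \<open>f (t1 e1 + t2 e2) = f1 t1 e1 + f2 t2 e2\<close>.  Since \<open>fl\<close>
  depends only on \<open>tl\<close>, it is read off on the diagonal \<open>t1 = t2\<close>.
\<close>

definition bc_fun1 :: "(bicomplex \<Rightarrow> bicomplex) \<Rightarrow> complex \<Rightarrow> complex"
  where "bc_fun1 f s = bc_proj1 (f (bc_idem s s))"

definition bc_fun2 :: "(bicomplex \<Rightarrow> bicomplex) \<Rightarrow> complex \<Rightarrow> complex"
  where "bc_fun2 f s = bc_proj2 (f (bc_idem s s))"

lemma bc_fun_componentwise:
  assumes "\<And>t1 t2. f (bc_idem t1 t2) = bc_idem (f1 t1) (f2 t2)"
  shows "bc_fun1 f = f1" "bc_fun2 f = f2"
  by (simp_all add: fun_eq_iff bc_fun1_def bc_fun2_def assms)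

type_synonym bc_curve = "(real \<Rightarrow> complex) \<times> (real \<Rightarrow> complex)"

definition bc_curve_integrable :: "(bicomplex \<Rightarrow> bicomplex) \<Rightarrow> bc_curve \<Rightarrow> real set \<Rightarrow> bool"
  where "bc_curve_integrable f \<gamma> I \<longleftrightarrow>
    curve_integrable (bc_fun1 f) (fst \<gamma>) I \<and> curve_integrable (bc_fun2 f) (snd \<gamma>) I"

definition bc_curve_integral :: "(bicomplex \<Rightarrow> bicomplex) \<Rightarrow> bc_curve \<Rightarrow> real set \<Rightarrow> bicomplex"
  where "bc_curve_integral f \<gamma> I =
    bc_idem (curve_integral (bc_fun1 f) (fst \<gamma>) I) (curve_integral (bc_fun2 f) (snd \<gamma>) I)"

text \<open>Over the parameter interval \<open>{0<..}\<close>, both components run along the half-line from \<open>0\<close> to \<open>\<infinity>\<close>.\<close>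

definition half_line :: bc_curve
  where "half_line = (complex_of_real, complex_of_real)"

lemma Miller_Ross_integrand_componentwise:
  "bc_exp (- bc_idem t1 t2) * bc_idem t1 t2 bc_powr W =
     bc_idem (exp (- t1) * cpower t1 (bc_proj1 W)) (exp (- t2) * cpower t2 (bc_proj2 W))"
proof -
  have "- bc_idem t1 t2 = bc_idem (- t1) (- t2)"
    by (simp add: bc_idem_explicit bicomplex_eq_iff field_simps)
  then show ?thesis
    by (simp add: bc_exp_def bc_power_def bc_idem_arith)
qed

end

theory Submission
  imports Defs
begin

text \<open>In the idempotent coordinates the claim splits into two independent complex ones. The
  components of \<open>V\<close> are \<alpha> - i\<beta> and \<alpha> + i\<beta>, with real parts Re
  \<alpha> + Im \<beta> and Re \<alpha> - Im \<beta>, so the hypothesis says that both exceed -1.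
  Euler's integral then gives \<Gamma>(\<nu> + r + 1) in each component for every r
  (\<open>curve_integral_Gamma\<close>, \<open>bc_curve_integral_Gamma\<close>), and the two series
  agree term by term. The quotients are genuine because \<Gamma> has no zeros in the right
  half-plane (\<open>bc_Gamma_dvd_1\<close>), and the series converges by the ratio test in each
  component (\<open>summable_power_rGamma\<close>, \<open>summable_bc_idem\<close>).\<close>

lemma bc_proj_arith [simp]:
  "bc_proj1 0 = 0" "bc_proj2 0 = 0" "bc_proj1 1 = 1" "bc_proj2 1 = 1"
  "bc_proj1 (Z + W) = bc_proj1 Z + bc_proj1 W" "bc_proj2 (Z + W) = bc_proj2 Z + bc_proj2 W"
  "bc_proj1 (Z * W) = bc_proj1 Z * bc_proj1 W" "bc_proj2 (Z * W) = bc_proj2 Z * bc_proj2 W"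
  by (simp_all add: bc_proj1_def bc_proj2_def algebra_simps flip: power2_eq_square)

lemma bc_proj_of_nat [simp]: "bc_proj1 (of_nat n) = of_nat n" "bc_proj2 (of_nat n) = of_nat n"
  by (induction n) simp_all

lemma bc_proj_power [simp]:
  "bc_proj1 (Z ^ n) = bc_proj1 Z ^ n" "bc_proj2 (Z ^ n) = bc_proj2 Z ^ n"
  by (induction n) simp_all

text \<open>Inverting each component gives the inverse. Dividing 1 expresses being a unit, which
  rules out the totalized values of bicomplex division.\<close>

lemma bc_idem_dvd_1:
  assumes "a \<noteq> 0" "b \<noteq> 0"
  shows "bc_idem a b dvd 1"
proof
  show "1 = bc_idem a b * bc_idem (inverse a) (inverse b)"
    using assms by (simp add: bc_idem_arith) (simp add: bc_idem_explicit bicomplex_eq_iff)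
qed

lemma norm_bc_idem: "norm (bc_idem a b) = sqrt (((cmod a)\<^sup>2 + (cmod b)\<^sup>2) / 2)"
proof -
  \<comment> \<open>The parallelogram law; up to factors of modulus 1/2, the Cartesian components
    are a + b and a - b.\<close>
  have "(cmod (a + b))\<^sup>2 + (cmod (a - b))\<^sup>2 = 2 * ((cmod a)\<^sup>2 + (cmod b)\<^sup>2)"
    by (simp add: cmod_power2 power2_sum power2_diff)
  then show ?thesis
    by (simp add: norm_bicomplex_def bc_idem_explicit norm_mult norm_divide power_divide
        flip: add_divide_distrib)
qed

lemma bounded_linear_bc_idem1: "bounded_linear (\<lambda>z. bc_idem z 0)"
proof (rule bounded_linear_intro[where K = 1])
  show "norm (bc_idem z 0) \<le> norm z * 1" for z
    unfolding norm_bc_idem by (rule real_le_lsqrt) auto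
qed (simp_all add: bc_idem_explicit bicomplex_eq_iff scaleR_bicomplex_def scaleR_conv_of_real field_simps)

lemma bounded_linear_bc_idem2: "bounded_linear (\<lambda>z. bc_idem 0 z)"
proof (rule bounded_linear_intro[where K = 1])
  show "norm (bc_idem 0 z) \<le> norm z * 1" for z
    unfolding norm_bc_idem by (rule real_le_lsqrt) auto
qed (simp_all add: bc_idem_explicit bicomplex_eq_iff scaleR_bicomplex_def scaleR_conv_of_real field_simps)

text \<open>Each idempotent embedding is bounded and linear, so it carries convergent complex series
  to convergent bicomplex ones.\<close>

lemma summable_bc_idem:
  assumes "summable f" "summable g"
  shows "summable (\<lambda>n. bc_idem (f n) (g n))"
proof -
  have "summable (\<lambda>n. bc_idem (f n) 0 + bc_idem 0 (g n))"
    by (intro summable_add bounded_linear.summable[OF bounded_linear_bc_idem1]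
        bounded_linear.summable[OF bounded_linear_bc_idem2] assms)
  then show ?thesis
    by (simp add: bc_idem_arith)
qed

lemma summable_power_rGamma:
  fixes x w :: complex
  shows "summable (\<lambda>n. x ^ n * rGamma (w + of_nat n))"
\<comment> \<open>By the functional equation, consecutive terms have ratio x / (w + n) wherever this
  makes sense. From this \<open>N\<close> on, the reverse triangle inequality gives |w + n| \<ge>
  2|x|. The estimate is multiplied out, so vanishing terms need no separate case.\<close>
proof (rule summable_ratio_test[where c = "1/2" and N = "nat \<lceil>2 * cmod x + cmod w\<rceil>"])
  fix n
  assume n: "n \<ge> nat \<lceil>2 * cmod x + cmod w\<rceil>"
  have "2 * cmod x \<le> real n - cmod w"
    using n by linarith
  also have "\<dots> \<le> cmod (w + of_nat n)"
    using norm_diff_ineq[of "of_nat n" w] by (simp add: add.commute)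
  finally have "2 * cmod x * (cmod x ^ n * cmod (rGamma (w + of_nat n + 1)))
      \<le> cmod (w + of_nat n) * (cmod x ^ n * cmod (rGamma (w + of_nat n + 1)))"
    by (intro mult_right_mono) auto
  also have "\<dots> = cmod x ^ n * cmod ((w + of_nat n) * rGamma (w + of_nat n + 1))"
    by (simp add: norm_mult)
  also have "\<dots> = cmod x ^ n * cmod (rGamma (w + of_nat n))"
    by (simp only: rGamma_plus1)
  finally show "cmod (x ^ Suc n * rGamma (w + of_nat (Suc n)))
      \<le> 1 / 2 * cmod (x ^ n * rGamma (w + of_nat n))"
    by (simp add: norm_mult norm_power add_ac mult_ac)
qed simp

text \<open>Poles are harmless: there \<open>Gamma\<close> is 0, and division by 0 gives 0, the
  value of the entire function \<open>rGamma\<close>.\<close>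

lemma summable_bc_Gamma: "summable (\<lambda>r. X ^ r / bc_Gamma (Y + of_nat r))"
  using summable_bc_idem[OF summable_power_rGamma[of "bc_proj1 X" "bc_proj1 Y"]
      summable_power_rGamma[of "bc_proj2 X" "bc_proj2 Y"]]
  by (simp add: divide_bicomplex_def bc_Gamma_def rGamma_inverse_Gamma divide_inverse)

lemma curve_integral_Gamma:
  assumes "Re w > - 1"
  shows "curve_integrable (\<lambda>t. exp (- t) * cpower t w) complex_of_real {0<..}"
    and "curve_integral (\<lambda>t. exp (- t) * cpower t w) complex_of_real {0<..} = Gamma (w + 1)"
proof -
  have deriv: "vector_derivative complex_of_real (at x within {0<..}) = 1" if "x \<in> {0<..}" for x
  proof -
    have "(complex_of_real has_vector_derivative 1) (at x)"
      using has_vector_derivative_of_real[OF DERIV_ident, of "at x"] by simp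
    moreover have "at x within {0<..} = at x"
      using that open_greaterThan by (rule at_within_open)
    ultimately show ?thesis
      by (simp only: vector_derivative_at)
  qed
  \<comment> \<open>The left side is Euler's integrand for \<Gamma> at w + 1. For x > 0,
    \<open>cpower\<close> is the principal power and the curve has unit speed.\<close>
  have eq: "complex_of_real x powr (w + 1 - 1) / of_real (exp x) = exp (- complex_of_real x)
      * cpower (complex_of_real x) w * vector_derivative complex_of_real (at x within {0<..})"
    if "x \<in> {0<..}" for x
    using that deriv[OF that]
    by (simp add: cpower_def exp_minus divide_inverse flip: exp_of_real)
  have "((\<lambda>x. complex_of_real x powr (w + 1 - 1) / of_real (exp x)) has_integral Gamma (w + 1)) {0<..}"
    using assms by (intro Gamma_integral_complex') simp
  from has_integral_eq[OF eq this]
  have "((\<lambda>x. exp (- complex_of_real x) * cpower (complex_of_real x) w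
      * vector_derivative complex_of_real (at x within {0<..})) has_integral Gamma (w + 1)) {0<..}" .
  then show "curve_integrable (\<lambda>t. exp (- t) * cpower t w) complex_of_real {0<..}"
    and "curve_integral (\<lambda>t. exp (- t) * cpower t w) complex_of_real {0<..} = Gamma (w + 1)"
    unfolding curve_integrable_def curve_integral_def
    by (simp_all only: has_integral_integrable_integral)
qed

lemma bc_curve_integral_Gamma:
  assumes "Re (bc_proj1 W) > - 1" "Re (bc_proj2 W) > - 1"
  shows "bc_curve_integrable (\<lambda>t. bc_exp (- t) * t bc_powr W) half_line {0<..}"
    and "bc_curve_integral (\<lambda>t. bc_exp (- t) * t bc_powr W) half_line {0<..} = bc_Gamma (W + 1)"
proof -
  let ?f = "\<lambda>t. bc_exp (- t) * t bc_powr W"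
  \<comment> \<open>Each component of the integrand depends on its own variable only, so reading it
    off on the diagonal loses nothing.\<close>
  note componentwise = bc_fun_componentwise[where f = ?f
      and ?f1.0 = "\<lambda>t. exp (- t) * cpower t (bc_proj1 W)"
      and ?f2.0 = "\<lambda>t. exp (- t) * cpower t (bc_proj2 W)",
      OF Miller_Ross_integrand_componentwise]
  show "bc_curve_integrable ?f half_line {0<..}"
    and "bc_curve_integral ?f half_line {0<..} = bc_Gamma (W + 1)"
    using assms by (simp_all add: bc_curve_integrable_def bc_curve_integral_def half_line_def
        bc_Gamma_def componentwise curve_integral_Gamma)
qed

lemma bc_Gamma_dvd_1:
  assumes "Re (bc_proj1 Y) > 0" "Re (bc_proj2 Y) > 0"
  shows "bc_Gamma Y dvd 1"
  unfolding bc_Gamma_def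
  \<comment> \<open>\<open>Gamma\<close> takes the value 0 only at its poles, the nonpositive
    integers.\<close>
  using assms by (intro bc_idem_dvd_1) (auto simp: Gamma_eq_zero_iff elim!: nonpos_Ints_cases)

theorem theorem3p3:
  fixes Z V C :: bicomplex and \<alpha> \<beta> :: complex
  assumes "V = bc_of \<alpha> + bc_j * bc_of \<beta>"
    and "Re \<alpha> + 1 > \<bar>Im \<beta>\<bar>"
  shows "(\<forall>r::nat. bc_curve_integrable (\<lambda>t. bc_exp (- t) * t bc_powr (V + of_nat r)) half_line {0<..}
             \<and> bc_curve_integral (\<lambda>t. bc_exp (- t) * t bc_powr (V + of_nat r)) half_line {0<..} dvd 1)
    \<and> summable (\<lambda>r. (C * Z) ^ r
          / bc_curve_integral (\<lambda>t. bc_exp (- t) * t bc_powr (V + of_nat r)) half_line {0<..})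
    \<and> miller_ross V C Z = Z bc_powr V * (\<Sum>r. (C * Z) ^ r
          / bc_curve_integral (\<lambda>t. bc_exp (- t) * t bc_powr (V + of_nat r)) half_line {0<..})"
proof -
  have V: "Re (bc_proj1 V) > - 1" "Re (bc_proj2 V) > - 1"
    using assms by (auto simp: bc_proj1_def bc_proj2_def bc_of_def bc_j_def)
  \<comment> \<open>Adding r \<ge> 0 moves both components to the right, so Euler's integral
    converges for every term.\<close>
  have *: "Re (bc_proj1 (V + of_nat r)) > - 1" "Re (bc_proj2 (V + of_nat r)) > - 1" for r
    using V by (simp_all add: less_le_trans)
  have "bc_Gamma (V + of_nat r + 1) dvd 1" for r
    using * [of r] by (intro bc_Gamma_dvd_1) simp_all
  moreover have "summable (\<lambda>r. (C * Z) ^ r / bc_Gamma (V + of_nat r + 1))"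
    using summable_bc_Gamma[of "C * Z" "V + 1"] by (simp add: add_ac)
  ultimately show ?thesis
    by (simp add: bc_curve_integral_Gamma[OF *] miller_ross_def)
qed

end
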